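(* Let $(A=V/L,J_E)$ be a polarized complex abelian variety of dimension $g$ with period matrix $\Pi_A=(E\;Z)\in M(g\times 2g,\mathbb{C})$ with respect to a basis $\alpha$ of $V$ and a symplectic basis $\beta$ of $L$, where $J_E=\begin{pmatrix}0&E\\-E&0\end{pmatrix}$, $E=\mathrm{diag}(d_1,\dots,d_g)$, and $Z\in\mathbb{H}_g$ is the Riemann matrix of $A$. For $f\in\mathrm{End}_{\mathbb{Q}}(A)$, consider the subvariety $A_f:=\mathrm{Im}(f)=V_f/L_f$ of dimension $h$ and a symplectic basis $\beta_f=\{u_1,\dots,u_{2h}\}$ for its lattice $L_f$. Let $i_f:A_f\to A$ be the natural inclusion, let $P_f:=\rho_r(i_f)\in M(2g\times 2h,\mathbb{Z})$ be the matrix of the rational representation of $i_f$ with respect to the bases $\beta_f$ and $\beta$, and let $D=\mathrm{diag}(n_1,\dots,n_h)$, with $(n_1,\dots,n_h)$ the type of the induced polarization on $A_f$. Write $\rho_r(i_f)=(\beta_{f_1}\;\beta_{f_2})$ with $\beta_{f_1},\beta_{f_2}\in M(2g\times h,\mathbb{Z})$. Then: (1) $\alpha_f=\{\frac1{n_1}u_1,\dots,\frac1{n_h}u_h\}$ is a basis for the complex vector space $V_f$, and the matrix $\rho_a(i_f)\in M(g\times h,\mathbb{C})$ of the analytic representation of $i_f$ with respect to the bases $\alpha_f$ and $\alpha$ is given by $$\rho_a(i_f)=(E\;Z)\,\beta_{f_1}\,D^{-1}.$$ (2) The period matrix of $A_f$ with respect to the bases $\alpha_f$ and $\beta_f$ is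 given by $\Pi_{A_f}=(D\;W)$, where $W\in\mathbb{H}_h$ is the unique solution to $$(E\;Z)\,\beta_{f_1}\,D^{-1}\,W=(E\;Z)\,\beta_{f_2}.$$
   Context: A polarization on $A=V/L$ is regarded as a nondegenerate integral alternating form on $L$, of type $(d_1,\dots,d_g)$; a basis $\beta=\{\lambda_1,\dots,\lambda_{2g}\}$ of $L$ is symplectic if the form has matrix $J_E=\begin{pmatrix}0&E\\-E&0\end{pmatrix}$, $E=\mathrm{diag}(d_1,\dots,d_g)$. Sign convention: for the alternating form $F$ with matrix $J_E$, extended $\mathbb{R}$-linearly to $V$, the form $(x,y)\mapsto F(x,iy)$ is symmetric positive definite. $\mathbb{H}_g=\{Z\in M(g\times g,\mathbb{C}):Z^t=Z,\ \mathrm{Im}\,Z>0\}$ is the Siegel space. The period matrix with respect to bases $\{v_1,\dots,v_g\}$ of $V$ and $\{\lambda_1,\dots,\lambda_{2g}\}$ of $L$ is the $g\times 2g$ complex matrix $(\Pi_{j,i})$ with $\lambda_i=\sum_j\Pi_{j,i}v_j$. If $\beta$ is symplectic and $v_i=\frac1{d_i}\lambda_i$ for $1\le i\le g$, it has the form $(E\;Z)$ with $Z\in\mathbb{H}_g$, called a Riemann matrix of $A$. For $f\in\mathrm{End}_{\mathbb{Q}}(A)=\mathrm{End}(A)\otimes\mathbb{Q}$, $\mathrm{Im}(f)$ denotes the abelian subvariety $\mathrm{Im}(mf)$ for any positive integer $m$ with $mf\in\mathrm{End}(A)$; its complex vector space and lattice are denoted $V_f\subset V$ and $L_f\subset L$,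 and it carries the polarization induced by restriction from $A$. The basis $\beta_f$ of $L_f$ is symplectic for this induced polarization, i.e. the restricted form has matrix $\begin{pmatrix}0&D\\-D&0\end{pmatrix}$ in $\beta_f$. For a homomorphism $\psi:V'/L'\to V/L$ with chosen bases, the analytic representation $\rho_a(\psi)$ is the matrix of the induced linear map $V'\to V$, and the rational representation $\rho_r(\psi)$ is the integral matrix of the induced map $L'\to L$ (acting on column coordinate vectors). *)

theory Defs
  imports
    Complex_Main
    "Jordan_Normal_Form.Matrix"
    "Jordan_Normal_Form.Gauss_Jordan_Elimination"
begin

text \<open>
  A complex vector space is an abelian group type together with a complex scalar
  multiplication \<open>scale\<close> satisfying the library locale \<open>vector_space\<close>; the same
  additive group is also a real vector space and a module over the integers.
  Bases are lists, because the rows and columns of the coordinate matrices below are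
  indexed by positions (starting at 0). Since the Algebra library has a locale
  \<open>module\<close> as well, the one of \<open>HOL.Modules\<close> is referred to by its qualified name.
\<close>

definition real_scale :: "(complex \<Rightarrow> 'v \<Rightarrow> 'v) \<Rightarrow> real \<Rightarrow> 'v \<Rightarrow> 'v" where
  "real_scale scale r v = scale (complex_of_real r) v"

definition int_scale :: "(complex \<Rightarrow> 'v \<Rightarrow> 'v) \<Rightarrow> int \<Rightarrow> 'v \<Rightarrow> 'v" where
  "int_scale scale k v = scale (complex_of_int k) v"

definition is_basis ::
  "('r::comm_ring_1 \<Rightarrow> 'v::ab_group_add \<Rightarrow> 'v) \<Rightarrow> 'v set \<Rightarrow> 'v list \<Rightarrow> bool" where
  "is_basis scale M bs \<longleftrightarrow>
     distinct bs \<and> \<not> Modules.module.dependent scale (set bs) \<and>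
     Modules.module.span scale (set bs) = M"

text \<open>
  The matrix whose \<open>j\<close>-th column consists of the coordinates of \<open>ws ! j\<close> in the
  basis \<open>bs\<close>, i.e. \<open>ws ! j\<close> is the sum over \<open>i\<close> of the \<open>(i,j)\<close>-entry times \<open>bs ! i\<close>.
\<close>
definition coord_mat ::
  "('r::comm_ring_1 \<Rightarrow> 'v::ab_group_add \<Rightarrow> 'v) \<Rightarrow> 'v list \<Rightarrow> 'v list \<Rightarrow> 'r mat" where
  "coord_mat scale bs ws =
     mat (length bs) (length ws)
       (\<lambda>(i, j). Modules.module.representation scale (set bs) (ws ! j) (bs ! i))"


section \<open>Complex tori and their homomorphisms\<close>

definition lattice_in ::
  "(complex \<Rightarrow> 'v::ab_group_add \<Rightarrow> 'v) \<Rightarrow> 'v set \<Rightarrow> 'v set \<Rightarrow> bool" where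
  "lattice_in scale V L \<longleftrightarrow>
     (\<exists>bs. is_basis (real_scale scale) V bs \<and>
           Modules.module.span (int_scale scale) (set bs) = L)"

text \<open>
  The torus \<open>V/L\<close> is represented by the pair \<open>V\<close>, \<open>L\<close>; \<open>V\<close> is a subspace of the
  ambient type, so that a torus and its subtori live in the same type.
\<close>
definition complex_torus ::
  "(complex \<Rightarrow> 'v::ab_group_add \<Rightarrow> 'v) \<Rightarrow> 'v set \<Rightarrow> 'v set \<Rightarrow> bool" where
  "complex_torus scale V L \<longleftrightarrow> Modules.module.subspace scale V \<and> lattice_in scale V L"

definition clinear_between ::
  "(complex \<Rightarrow> 'v::ab_group_add \<Rightarrow> 'v) \<Rightarrow> 'v set \<Rightarrow> 'v set \<Rightarrow> ('v \<Rightarrow> 'v) \<Rightarrow> bool" where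
  "clinear_between scale V' V \<phi> \<longleftrightarrow>
     \<phi> ` V' \<subseteq> V \<and>
     (\<forall>x\<in>V'. \<forall>y\<in>V'. \<phi> (x + y) = \<phi> x + \<phi> y) \<and>
     (\<forall>c. \<forall>x\<in>V'. \<phi> (scale c x) = scale c (\<phi> x))"

text \<open>
  A homomorphism \<open>V'/L' \<rightarrow> V/L\<close> is represented by the complex linear map \<open>V' \<rightarrow> V\<close>
  inducing it, which is unique on \<open>V'\<close>; values outside \<open>V'\<close> are irrelevant.
\<close>
definition torus_hom ::
  "(complex \<Rightarrow> 'v::ab_group_add \<Rightarrow> 'v) \<Rightarrow> 'v set \<Rightarrow> 'v set \<Rightarrow> 'v set \<Rightarrow> 'v set \<Rightarrow>
     ('v \<Rightarrow> 'v) \<Rightarrow> bool" where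
  "torus_hom scale V' L' V L \<phi> \<longleftrightarrow> clinear_between scale V' V \<phi> \<and> \<phi> ` L' \<subseteq> L"

definition torus_End ::
  "(complex \<Rightarrow> 'v::ab_group_add \<Rightarrow> 'v) \<Rightarrow> 'v set \<Rightarrow> 'v set \<Rightarrow> ('v \<Rightarrow> 'v) set" where
  "torus_End scale V L = {\<phi>. torus_hom scale V L V L \<phi>}"

text \<open>
  \<open>End(A)\<close> is torsion free, so every element of its tensor product with the rationals is
  \<open>\<phi>/m\<close> with \<open>\<phi>\<close> in \<open>End(A)\<close> and a positive integer \<open>m\<close>; it is represented by the
  corresponding complex linear map of \<open>V\<close>.
\<close>
definition torus_EndQ ::
  "(complex \<Rightarrow> 'v::ab_group_add \<Rightarrow> 'v) \<Rightarrow> 'v set \<Rightarrow> 'v set \<Rightarrow> ('v \<Rightarrow> 'v) set" where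
  "torus_EndQ scale V L =
     {f. clinear_between scale V V f \<and>
         (\<exists>m::nat. m > 0 \<and> (\<lambda>v. scale (of_nat m) (f v)) \<in> torus_End scale V L)}"

text \<open>
  The image in \<open>V/L\<close> of the homomorphism induced by \<open>\<phi>\<close> is \<open>(\<phi>(V) + L)/L\<close>, which is the
  subtorus with vector space \<open>\<phi>(V)\<close> and lattice \<open>\<phi>(V) \<inter> L\<close>.
\<close>
definition image_space :: "'v set \<Rightarrow> ('v \<Rightarrow> 'v) \<Rightarrow> 'v set" where
  "image_space V \<phi> = \<phi> ` V"

definition image_lattice :: "'v set \<Rightarrow> 'v set \<Rightarrow> ('v \<Rightarrow> 'v) \<Rightarrow> 'v set" where
  "image_lattice V L \<phi> = image_space V \<phi> \<inter> L"

definition analytic_rep ::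
  "(complex \<Rightarrow> 'v::ab_group_add \<Rightarrow> 'v) \<Rightarrow> ('v \<Rightarrow> 'v) \<Rightarrow> 'v list \<Rightarrow> 'v list \<Rightarrow> complex mat" where
  "analytic_rep scale \<phi> \<alpha>' \<alpha> = coord_mat scale \<alpha> (map \<phi> \<alpha>')"

definition rational_rep ::
  "(complex \<Rightarrow> 'v::ab_group_add \<Rightarrow> 'v) \<Rightarrow> ('v \<Rightarrow> 'v) \<Rightarrow> 'v list \<Rightarrow> 'v list \<Rightarrow> int mat" where
  "rational_rep scale \<phi> \<beta>' \<beta> = coord_mat (int_scale scale) \<beta> (map \<phi> \<beta>')"

definition period_matrix ::
  "(complex \<Rightarrow> 'v::ab_group_add \<Rightarrow> 'v) \<Rightarrow> 'v list \<Rightarrow> 'v list \<Rightarrow> complex mat" where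
  "period_matrix scale \<alpha> \<beta> = coord_mat scale \<alpha> \<beta>"


section \<open>Polarizations\<close>

text \<open>
  The alternating form on the lattice is given by its real bilinear extension \<open>F\<close> to \<open>V\<close>.
  The sign convention is that \<open>F(x, \<i>y)\<close> (not \<open>F(\<i>x, y)\<close>) is positive definite.
\<close>
definition polarization ::
  "(complex \<Rightarrow> 'v::ab_group_add \<Rightarrow> 'v) \<Rightarrow> 'v set \<Rightarrow> 'v set \<Rightarrow> ('v \<Rightarrow> 'v \<Rightarrow> real) \<Rightarrow> bool" where
  "polarization scale V L F \<longleftrightarrow>
     (\<forall>x\<in>V. \<forall>y\<in>V. \<forall>z\<in>V. F (x + y) z = F x z + F y z \<and> F z (x + y) = F z x + F z y) \<and>
     (\<forall>r. \<forall>x\<in>V. \<forall>y\<in>V. F (real_scale scale r x) y = r * F x y \<and>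
                        F x (real_scale scale r y) = r * F x y) \<and>
     (\<forall>x\<in>V. F x x = 0) \<and>
     (\<forall>x\<in>L. \<forall>y\<in>L. F x y \<in> \<int>) \<and>
     (\<forall>x\<in>L. (\<forall>y\<in>L. F x y = 0) \<longrightarrow> x = 0) \<and>
     (\<forall>x\<in>V. \<forall>y\<in>V. F x (scale \<i> y) = F y (scale \<i> x)) \<and>
     (\<forall>x\<in>V. x \<noteq> 0 \<longrightarrow> F x (scale \<i> x) > 0)"

definition diag_of :: "nat list \<Rightarrow> 'a::semiring_1 mat" where
  "diag_of ds = mat_diag (length ds) (\<lambda>i. of_nat (ds ! i))"

definition J_mat :: "nat list \<Rightarrow> 'a::ring_1 mat" where
  "J_mat ds =
     four_block_mat (0\<^sub>m (length ds) (length ds)) (diag_of ds)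
                    (- diag_of ds) (0\<^sub>m (length ds) (length ds))"

definition gram_mat :: "('v \<Rightarrow> 'v \<Rightarrow> real) \<Rightarrow> 'v list \<Rightarrow> real mat" where
  "gram_mat F bs = mat (length bs) (length bs) (\<lambda>(i, j). F (bs ! i) (bs ! j))"

definition symplectic_basis ::
  "(complex \<Rightarrow> 'v::ab_group_add \<Rightarrow> 'v) \<Rightarrow> 'v set \<Rightarrow> ('v \<Rightarrow> 'v \<Rightarrow> real) \<Rightarrow> nat list \<Rightarrow>
     'v list \<Rightarrow> bool" where
  "symplectic_basis scale L F ds \<beta> \<longleftrightarrow>
     is_basis (int_scale scale) L \<beta> \<and> gram_mat F \<beta> = J_mat ds"

definition has_type ::
  "(complex \<Rightarrow> 'v::ab_group_add \<Rightarrow> 'v) \<Rightarrow> 'v set \<Rightarrow> ('v \<Rightarrow> 'v \<Rightarrow> real) \<Rightarrow> nat list \<Rightarrow> bool" where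
  "has_type scale L F ds \<longleftrightarrow>
     (\<forall>d\<in>set ds. d > 0) \<and> sorted_wrt (dvd) ds \<and> (\<exists>\<beta>. symplectic_basis scale L F ds \<beta>)"


section \<open>Siegel space and block matrices\<close>

definition siegel :: "nat \<Rightarrow> complex mat set" where
  "siegel n = {Z \<in> carrier_mat n n. transpose_mat Z = Z \<and>
     (\<forall>x \<in> carrier_vec n. x \<noteq> 0\<^sub>v n \<longrightarrow> 0 < x \<bullet> (map_mat Im Z *\<^sub>v x))}"

definition hcat :: "'a::zero mat \<Rightarrow> 'a mat \<Rightarrow> 'a mat" where
  "hcat A B = four_block_mat A B (0\<^sub>m 0 (dim_col A)) (0\<^sub>m 0 (dim_col B))"

text \<open>The library's inversion algorithm returns an option, \<open>None\<close> for singular matrices.\<close>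
definition mat_inv :: "'a::field mat \<Rightarrow> 'a mat" where
  "mat_inv A = the (mat_inverse A)"

end

theory Submission
  imports Defs
begin

text \<open>
  Put \<open>a\<^sub>i = u\<^sub>i / n\<^sub>i\<close> and \<open>w\<^sub>j = u\<^sub>h\<^sub>+\<^sub>j\<close>, so that \<open>F(a\<^sub>i, a\<^sub>j) = F(w\<^sub>i, w\<^sub>j) = 0\<close> and
  \<open>F(a\<^sub>i, w\<^sub>j) = \<delta>\<^sub>i\<^sub>j\<close>. Positivity of \<open>F(y, \<i>y)\<close> makes the \<open>a\<^sub>i\<close> linearly independent over the
  complex numbers, and there are \<open>h\<close> of them. Let \<open>W\<close> be the coordinate matrix of the \<open>w\<^sub>j\<close> and
  write \<open>w\<^sub>j = x\<^sub>j + \<i>y\<^sub>j\<close> with \<open>x\<^sub>j, y\<^sub>j\<close> in the real span of the \<open>a\<^sub>i\<close>. Then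
  \<open>Im W\<^sub>k\<^sub>j = F(y\<^sub>j, w\<^sub>k) = F(y\<^sub>j, \<i>y\<^sub>k)\<close> is symmetric and positive, and expanding
  \<open>F(w\<^sub>j, w\<^sub>k) = 0\<close> shows that \<open>Re W\<close> is symmetric. The matrix identities are changes of basis.
\<close>

section \<open>Coordinates with respect to a list\<close>

context Modules.module
begin

text \<open>Matrix columns are indexed by positions, set independence by elements. The indexed
  condition on the right also forces distinctness, since a repeated entry would give a nontrivial
  relation.\<close>

lemma distinct_independent_list_iff:
  "distinct bs \<and> independent (set bs) \<longleftrightarrow>
     (\<forall>c. (\<Sum>i<length bs. c i *s bs ! i) = 0 \<longrightarrow> (\<forall>i<length bs. c i = 0))"
    (is "?L \<longleftrightarrow> ?R")
proof
  assume L: ?L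
  show ?R
  proof (intro allI impI)
    fix c i
    assume c: "(\<Sum>i<length bs. c i *s bs ! i) = 0" and i: "i < length bs"
    define idx where "idx = the_inv_into {..<length bs} ((!) bs)"
    have inj: "inj_on ((!) bs) {..<length bs}"
      using L by (auto intro!: inj_onI simp: nth_eq_iff_index_eq)
    have idx: "idx (bs ! k) = k" if "k < length bs" for k
      using that inj by (simp add: idx_def the_inv_into_f_f)
    have "(\<Sum>v\<in>set bs. c (idx v) *s v) = (\<Sum>v\<in>(!) bs ` {..<length bs}. c (idx v) *s v)"
      by (rule sum.cong) (auto simp: set_conv_nth)
    also have "\<dots> = (\<Sum>i<length bs. c i *s bs ! i)"
      by (simp add: sum.reindex[OF inj] idx)
    finally have "c (idx (bs ! i)) = 0"
      using L c i by (intro independentD[of "set bs" "set bs"]) auto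
    then show "c i = 0" by (simp add: idx i)
  qed
next
  assume R: ?R
  have dist: "distinct bs"
  proof (rule ccontr)
    assume "\<not> distinct bs"
    then obtain i j where ij: "i < length bs" "j < length bs" "i \<noteq> j" "bs ! i = bs ! j"
      by (auto simp: distinct_conv_nth)
    let ?c = "\<lambda>k. (if k = i then 1 else 0) - (if k = j then 1 else 0) :: 'a"
    have *: "(\<Sum>k<length bs. (if k = l then 1 else 0) *s bs ! k) = bs ! l" if "l < length bs" for l
    proof -
      have "(\<Sum>k<length bs. (if k = l then 1 else 0) *s bs ! k) =
            (\<Sum>k<length bs. if k = l then bs ! k else 0)"
        by (rule sum.cong) auto
      then show ?thesis using that by simp
    qed
    have "(\<Sum>k<length bs. ?c k *s bs ! k) = 0"
      using ij by (simp only: scale_left_diff_distrib sum_subtractf *) simp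
    with spec[OF R, of ?c] have "\<forall>k<length bs. ?c k = 0" by (rule mp)
    with ij(1) have "?c i = 0" by blast
    with ij(3) show False by simp
  qed
  have inj: "inj_on ((!) bs) {..<length bs}"
    using dist by (auto intro!: inj_onI simp: nth_eq_iff_index_eq)
  have "independent (set bs)"
  proof (subst dependent_finite, simp, clarify)
    fix u v assume v: "v \<in> set bs" "u v \<noteq> 0" and s: "(\<Sum>v\<in>set bs. u v *s v) = 0"
    have "(\<Sum>v\<in>set bs. u v *s v) = (\<Sum>v\<in>(!) bs ` {..<length bs}. u v *s v)"
      by (rule sum.cong) (auto simp: set_conv_nth)
    also have "\<dots> = (\<Sum>i<length bs. u (bs ! i) *s bs ! i)"
      by (simp add: sum.reindex[OF inj])
    finally have "\<forall>i<length bs. u (bs ! i) = 0" using R s by auto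
    with v show False by (auto simp: in_set_conv_nth)
  qed
  with dist show ?L by blast
qed

text \<open>\<open>representation\<close> is identically 0 on vectors outside the span, so the
  expansion is tied to span membership.\<close>

lemma coord_mat_expand:
  assumes "distinct bs" "independent (set bs)" "ws ! j \<in> span (set bs)" "j < length ws"
  shows "ws ! j = (\<Sum>i<length bs. coord_mat scale bs ws $$ (i, j) *s bs ! i)"
proof -
  have inj: "inj_on ((!) bs) {..<length bs}"
    using assms(1) by (auto intro!: inj_onI simp: nth_eq_iff_index_eq)
  have "ws ! j = (\<Sum>b\<in>set bs. representation (set bs) (ws ! j) b *s b)"
    using assms by (intro sum_representation_eq[symmetric]) auto
  also have "\<dots> = (\<Sum>b\<in>(!) bs ` {..<length bs}. representation (set bs) (ws ! j) b *s b)"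
    by (rule sum.cong) (auto simp: set_conv_nth)
  also have "\<dots> = (\<Sum>i<length bs. coord_mat scale bs ws $$ (i, j) *s bs ! i)"
    using assms(4) by (simp add: sum.reindex[OF inj] coord_mat_def)
  finally show ?thesis .
qed

text \<open>Change of coordinates, from linearity of \<open>representation\<close>. The list
  \<open>cs\<close> may be dependent: one use takes for it a lattice basis, which has twice as many
  vectors as the complex dimension.\<close>

lemma coord_mat_mult:
  assumes "independent (set bs)" "set cs \<subseteq> span (set bs)"
    and M: "M \<in> carrier_mat (length cs) (length ws)"
    and ws: "\<And>j. j < length ws \<Longrightarrow> ws ! j = (\<Sum>k<length cs. M $$ (k, j) *s cs ! k)"
  shows "coord_mat scale bs ws = coord_mat scale bs cs * M"
proof (rule eq_matI)
  fix i j assume "i < dim_row (coord_mat scale bs cs * M)" "j < dim_col (coord_mat scale bs cs * M)"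
  then have i: "i < length bs" and j: "j < length ws" using M by (auto simp: coord_mat_def)
  have "representation (set bs) (ws ! j) (bs ! i) =
        (\<Sum>k<length cs. M $$ (k, j) * representation (set bs) (cs ! k) (bs ! i))"
  proof -
    have cs: "cs ! k \<in> span (set bs)" if "k < length cs" for k
      using assms(2) that by auto
    show ?thesis
      unfolding ws[OF j] using assms(1) cs
      by (subst representation_sum) (auto simp: span_scale representation_scale)
  qed
  then show "coord_mat scale bs ws $$ (i, j) = (coord_mat scale bs cs * M) $$ (i, j)"
    using M i j by (simp add: coord_mat_def scalar_prod_def atLeast0LessThan mult.commute)
qed (use M in \<open>auto simp: coord_mat_def\<close>)

text \<open>An independent list has an injective coordinate map, square or not: matrices with equal
  products describe the same combinations of \<open>cs\<close>, whose coefficients are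
  unique.\<close>

lemma coord_mat_mult_cancel:
  assumes b: "distinct bs" "independent (set bs)"
    and c: "distinct cs" "independent (set cs)" "set cs \<subseteq> span (set bs)"
    and M: "M \<in> carrier_mat (length cs) n" and N: "N \<in> carrier_mat (length cs) n"
    and eq: "coord_mat scale bs cs * M = coord_mat scale bs cs * N"
  shows "M = N"
proof -
  define lc where "lc P = map (\<lambda>j. \<Sum>k<length cs. P $$ (k, j) *s cs ! k) [0..<n]" for P :: "'a mat"
  have lc: "coord_mat scale bs (lc P) = coord_mat scale bs cs * P" if "P \<in> carrier_mat (length cs) n" for P
    using b(2) c(3) that by (intro coord_mat_mult) (auto simp: lc_def)
  have "cs ! k \<in> span (set bs)" if "k < length cs" for k
    using c(3) that by auto
  then have sp: "lc P ! j \<in> span (set bs)" if "j < n" for P j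
    using that by (auto simp: lc_def intro!: span_sum span_scale)
  have "lc M ! j = lc N ! j" if "j < n" for j
    using coord_mat_expand[OF b sp[OF that], of M] coord_mat_expand[OF b sp[OF that], of N] that
    by (simp add: lc M N eq) (simp add: lc_def)
  then have *: "(\<Sum>k<length cs. (M $$ (k, j) - N $$ (k, j)) *s cs ! k) = 0" if "j < n" for j
    using that by (simp add: lc_def scale_left_diff_distrib sum_subtractf)
  show ?thesis
  proof (rule eq_matI)
    fix i j assume "i < dim_row N" "j < dim_col N"
    then have "i < length cs" "j < n" using N by auto
    moreover have "\<forall>i<length cs. M $$ (i, j) - N $$ (i, j) = 0"
      using distinct_independent_list_iff[of cs] c(1,2) *[OF \<open>j < n\<close>]
      by (elim iffE) (drule mp, simp, drule spec[where x = "\<lambda>i. M $$ (i, j) - N $$ (i, j)"], simp)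
    ultimately show "M $$ (i, j) = N $$ (i, j)" by simp
  qed (use M N in auto)
qed

end

text \<open>A vector of \<open>S\<close> outside \<open>span B\<close> would enlarge
  \<open>B\<close> beyond the size of a basis of \<open>S\<close>. The finite \<open>T\<close> makes
  the cardinalities meaningful, \<open>card\<close> being 0 on infinite sets.\<close>

lemma (in vector_space) span_eq_of_card_ge_dim:
  assumes S: "S \<subseteq> span T" "finite T" "subspace S"
    and B: "B \<subseteq> S" "independent B" "dim S \<le> card B"
  shows "span B = S"
proof
  show "span B \<subseteq> S" using B(1) S(3) by (rule span_minimal)
  obtain C where C: "C \<subseteq> S" "independent C" "S \<subseteq> span C" "card C = dim S"
    by (rule basis_exists)
  have fC: "finite C" using independent_span_bound[OF S(2) C(2)] C(1) S(1) by auto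
  have fB: "finite B" using independent_span_bound[OF fC B(2)] B(1) C(3) by auto
  show "S \<subseteq> span B"
  proof (rule subsetI, rule ccontr)
    fix v assume v: "v \<in> S" "v \<notin> span B"
    then have "independent (insert v B)" using B(2) by (simp add: independent_insertI)
    moreover have "insert v B \<subseteq> span C" using v(1) B(1) C(3) by auto
    ultimately have "card (insert v B) \<le> card C" using independent_span_bound[OF fC] by blast
    moreover have "v \<notin> B" using v(2) by (meson span_base)
    ultimately show False using fB C(4) B(3) by simp
  qed
qed

lemma restricted_scalars_module:
  assumes "vector_space scale"
  shows "Modules.module (int_scale scale)" and "Modules.module (real_scale scale)"
proof -
  interpret vector_space scale by fact
  show "Modules.module (int_scale scale)"
    by unfold_locales (auto simp: int_scale_def algebra_simps)
  show "Modules.module (real_scale scale)"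
    by unfold_locales (auto simp: real_scale_def algebra_simps)
qed

lemma complex_torus_lattice_subset:
  assumes "vector_space scale" "complex_torus scale V L"
  shows "L \<subseteq> V"
proof -
  interpret vector_space scale by fact
  interpret Z: Modules.module "int_scale scale"
    using assms(1) by (rule restricted_scalars_module)
  interpret R: Modules.module "real_scale scale"
    using assms(1) by (rule restricted_scalars_module)
  obtain bs where bs: "R.span (set bs) = V" "Z.span (set bs) = L"
    using assms(2) by (auto simp: complex_torus_def lattice_in_def is_basis_def)
  have V: "subspace V" using assms(2) by (simp add: complex_torus_def)
  have "Z.subspace V"
    using V by (simp add: Z.subspace_def subspace_def int_scale_def)
  then show ?thesis using Z.span_minimal[of "set bs" V] R.span_superset[of "set bs"] bs by simp
qed

lemma mat_inv_mat_diag: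
  fixes c :: "nat \<Rightarrow> 'a::field"
  assumes "\<And>i. i < n \<Longrightarrow> c i \<noteq> 0"
  shows "mat_inv (mat_diag n c) = mat_diag n (\<lambda>i. 1 / c i)"
proof -
  let ?A = "mat_diag n c" and ?B = "mat_diag n (\<lambda>i. 1 / c i)"
  have AB: "?A * ?B = 1\<^sub>m n" "?B * ?A = 1\<^sub>m n"
    unfolding mat_diag_diag by (auto simp: mat_diag_def assms intro!: eq_matI)
  \<comment> \<open>The inversion algorithm returns \<open>None\<close> only outside the unit group,
    so exhibiting an inverse forces a \<open>Some\<close>; uniqueness of inverses then identifies
    the result.\<close>
  have "?A \<in> Units (ring_mat TYPE('a) n ())"
    using AB by (auto simp: Units_def ring_mat_def intro!: bexI[of _ ?B])
  then obtain C where C: "mat_inverse ?A = Some C"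
    using mat_inverse(1)[of ?A n "()"] by fastforce
  then have C': "C * ?A = 1\<^sub>m n" "C \<in> carrier_mat n n"
    using mat_inverse(2)[of ?A n C] by auto
  have "C = C * (?A * ?B)" using C'(2) by (simp only: AB) simp
  also have "\<dots> = (C * ?A) * ?B" 
    by (rule assoc_mult_mat[of _ n n _ n _ n, symmetric]) (use C' in auto)
  also have "\<dots> = ?B" unfolding C'(1) by (rule left_mult_one_mat[of _ n n]) simp
  finally show ?thesis by (simp add: mat_inv_def C)
qed

section \<open>Lagrangian frames\<close>

text \<open>\<open>F\<close> is constrained only on \<open>V\<close>, hence the membership premises
  throughout.\<close>

locale polarized_space = vector_space scale
  for scale :: "complex \<Rightarrow> 'v::ab_group_add \<Rightarrow> 'v" (infixr "*c" 75) +
  fixes V L :: "'v set" and F :: "'v \<Rightarrow> 'v \<Rightarrow> real"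
  assumes subspace_V: "subspace V" and pol: "polarization scale V L F"
begin

lemma F_add:
  assumes "x \<in> V" "y \<in> V" "z \<in> V"
  shows "F (x + y) z = F x z + F y z" "F z (x + y) = F z x + F z y"
  using pol[unfolded polarization_def, THEN conjunct1] assms by simp_all

lemma F_scale:
  assumes "x \<in> V" "y \<in> V"
  shows "F (of_real r *c x) y = r * F x y" "F x (of_real r *c y) = r * F x y"
  using pol[unfolded polarization_def, THEN conjunct2, THEN conjunct1] assms
  by (simp_all add: real_scale_def)

lemma F_self: "x \<in> V \<Longrightarrow> F x x = 0"
  using pol unfolding polarization_def by (elim conjE) (rule bspec)

lemma F_i_sym: "x \<in> V \<Longrightarrow> y \<in> V \<Longrightarrow> F x (\<i> *c y) = F y (\<i> *c x)"
  using pol unfolding polarization_def by (elim conjE) simp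

lemma F_i_pos: "x \<in> V \<Longrightarrow> x \<noteq> 0 \<Longrightarrow> F x (\<i> *c x) > 0"
  using pol unfolding polarization_def by (elim conjE) simp

lemma V_scale: "x \<in> V \<Longrightarrow> c *c x \<in> V"
  using subspace_V by (rule subspace_scale)

lemma F_swap:
  assumes "x \<in> V" "y \<in> V"
  shows "F y x = - F x y"
proof -
  have "0 = F (x + y) (x + y)" using F_self subspace_add[OF subspace_V assms] by simp
  also have "\<dots> = F x y + F y x"
    using assms by (simp add: F_add subspace_add[OF subspace_V]) (simp add: F_self)
  finally show ?thesis by simp
qed

lemma F_zero:
  assumes "x \<in> V"
  shows "F 0 x = 0" "F x 0 = 0"
  using F_scale[OF assms assms, of 0] by simp_all

text \<open>The symmetry \<open>F_i_sym\<close> moves one factor \<i> across; then the sign of its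
  square and the sign of antisymmetry cancel.\<close>

lemma F_i_i:
  assumes "x \<in> V" "y \<in> V"
  shows "F (\<i> *c x) (\<i> *c y) = F x y"
proof -
  have "F (\<i> *c x) (\<i> *c y) = F y (\<i> *c (\<i> *c x))"
    using assms by (intro F_i_sym V_scale)
  also have "\<i> *c (\<i> *c x) = of_real (-1) *c x" by simp
  also have "F y (of_real (-1) *c x) = F x y"
    using F_scale(2)[OF assms(2,1), of "-1"] F_swap[OF assms] by simp
  finally show ?thesis .
qed

lemma F_sum_left:
  assumes "\<And>i. i \<in> I \<Longrightarrow> v i \<in> V" "x \<in> V"
  shows "F (\<Sum>i\<in>I. of_real (c i) *c v i) x = (\<Sum>i\<in>I. c i * F (v i) x)"
  using assms(1)
proof (induction I rule: infinite_finite_induct)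
  case (insert j I)
  have "(\<Sum>i\<in>I. of_real (c i) *c v i) \<in> V"
    using insert.prems by (intro subspace_sum[OF subspace_V] V_scale) simp
  moreover have "of_real (c j) *c v j \<in> V" using insert.prems by (simp add: V_scale)
  ultimately have "F (\<Sum>i\<in>insert j I. of_real (c i) *c v i) x =
      F (of_real (c j) *c v j) x + F (\<Sum>i\<in>I. of_real (c i) *c v i) x"
    using insert.hyps assms(2) by (simp add: F_add(1))
  moreover have "F (of_real (c j) *c v j) x = c j * F (v j) x"
    using insert.prems assms(2) by (intro F_scale) auto
  ultimately show ?case using insert by simp
qed (simp_all add: F_zero assms(2))

lemma F_sum_right:
  assumes "\<And>i. i \<in> I \<Longrightarrow> v i \<in> V" "x \<in> V"
  shows "F x (\<Sum>i\<in>I. of_real (c i) *c v i) = (\<Sum>i\<in>I. c i * F x (v i))"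
proof -
  have "(\<Sum>i\<in>I. of_real (c i) *c v i) \<in> V"
    using assms(1) by (intro subspace_sum[OF subspace_V] V_scale)
  then have "F x (\<Sum>i\<in>I. of_real (c i) *c v i) = - (\<Sum>i\<in>I. c i * F (v i) x)"
    by (simp only: F_swap[OF _ assms(2)] F_sum_left[OF assms])
  also have "\<dots> = (\<Sum>i\<in>I. c i * F x (v i))"
    unfolding sum_negf[symmetric]
  proof (rule sum.cong)
    fix i assume "i \<in> I"
    then show "- (c i * F (v i) x) = c i * F x (v i)"
      using F_swap[of x "v i"] assms by simp
  qed simp
  finally show ?thesis .
qed

end

text \<open>A Darboux-type family inside \<open>V\<close> that is not assumed to span it, so a
  subvariety can be treated inside its ambient space.\<close>

locale lagrangian_frame = polarized_space +
  fixes n :: nat and a w :: "nat \<Rightarrow> 'a"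
  assumes a_V: "i < n \<Longrightarrow> a i \<in> V" and w_V: "i < n \<Longrightarrow> w i \<in> V"
    and F_a_a: "i < n \<Longrightarrow> j < n \<Longrightarrow> F (a i) (a j) = 0"
    and F_w_w: "i < n \<Longrightarrow> j < n \<Longrightarrow> F (w i) (w j) = 0"
    and F_a_w: "i < n \<Longrightarrow> j < n \<Longrightarrow> F (a i) (w j) = (if i = j then 1 else 0)"
begin

definition real_comb :: "(nat \<Rightarrow> real) \<Rightarrow> 'a" where
  "real_comb c = (\<Sum>i<n. of_real (c i) *c a i)"

lemma real_comb_V: "real_comb c \<in> V"
  unfolding real_comb_def by (auto intro!: subspace_sum[OF subspace_V] V_scale a_V)

lemma F_comb_comb: "F (real_comb c) (real_comb d) = 0"
proof -
  have "F (a i) (real_comb d) = 0" if "i < n" for i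
    unfolding real_comb_def using that by (subst F_sum_right) (auto simp: a_V F_a_a)
  then show ?thesis
    by (subst real_comb_def, subst F_sum_left) (auto simp: a_V real_comb_V)
qed

text \<open>Duality of \<open>a\<close> and \<open>w\<close> makes pairing with \<open>w k\<close> a
  coordinate functional on the real span of the \<open>a i\<close>.\<close>

lemma F_comb_w: "k < n \<Longrightarrow> F (real_comb c) (w k) = c k"
  unfolding real_comb_def by (subst F_sum_left) (auto simp: a_V w_V F_a_w if_distrib cong: if_cong)

lemma complex_comb_eq:
  "(\<Sum>i<n. c i *c a i) = real_comb (\<lambda>i. Re (c i)) + \<i> *c real_comb (\<lambda>i. Im (c i))"
proof -
  have "c i *c a i = of_real (Re (c i)) *c a i + \<i> *c (of_real (Im (c i)) *c a i)" for i
    by (subst complex_eq[of "c i"]) (simp only: scale_left_distrib scale_scale)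
  then show ?thesis
    unfolding real_comb_def by (simp only: scale_sum_right sum.distrib)
qed

text \<open>If \<open>x + \<i>y = 0\<close> with \<open>x, y\<close> in the real span of the isotropic vectors, then
  \<open>F(y, \<i>y) = F(y, x + \<i>y) = 0\<close>, so \<open>y = 0\<close> by positivity.\<close>
lemma complex_comb_eq_0:
  assumes "(\<Sum>i<n. c i *c a i) = 0" "k < n"
  shows "c k = 0"
proof -
  let ?x = "real_comb (\<lambda>i. Re (c i))" and ?y = "real_comb (\<lambda>i. Im (c i))"
  have xy: "?x + \<i> *c ?y = 0" using assms(1) by (simp add: complex_comb_eq)
  have "F ?y (?x + \<i> *c ?y) = F ?y (\<i> *c ?y)"
    by (simp add: F_add real_comb_V V_scale F_comb_comb)
  then have y: "?y = 0"
    using F_i_pos[of ?y] by (auto simp: xy F_zero real_comb_V)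
  with xy have x: "?x = 0" by simp
  \<comment> \<open>With both parts zero, pairing with \<open>w k\<close> returns the real and
    imaginary parts of \<open>c k\<close>.\<close>
  show ?thesis
    using F_comb_w[OF assms(2), of "\<lambda>i. Re (c i)"] F_comb_w[OF assms(2), of "\<lambda>i. Im (c i)"]
    by (simp add: x y F_zero w_V assms(2) complex_eq_iff)
qed

lemma frame_matrix_siegel:
  assumes W: "W \<in> carrier_mat n n"
    and w: "\<And>j. j < n \<Longrightarrow> w j = (\<Sum>i<n. W $$ (i, j) *c a i)"
  shows "W \<in> siegel n"
proof -
  define x y where "x j = real_comb (\<lambda>i. Re (W $$ (i, j)))"
    and "y j = real_comb (\<lambda>i. Im (W $$ (i, j)))" for j
  have w': "w j = x j + \<i> *c y j" if "j < n" for j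
    by (simp add: w that complex_comb_eq x_def y_def)
  have V: "x j \<in> V" "y j \<in> V" "\<i> *c x j \<in> V" "\<i> *c y j \<in> V" for j
    by (simp_all add: x_def y_def real_comb_V V_scale)
  have iso: "F (x j) (x k) = 0" "F (y j) (x k) = 0" "F (y j) (y k) = 0" for j k
    by (simp_all add: x_def y_def F_comb_comb)
  \<comment> \<open>The indices are reversed: pairing with \<open>w k\<close> reads the
    \<open>k\<close>-th coordinate of \<open>x j\<close>, and isotropy removes the summand
    \<open>x k\<close> of \<open>w k\<close>.\<close>
  have Re_eq: "F (x j) (\<i> *c y k) = Re (W $$ (k, j))" if "k < n" for j k
  proof -
    have "F (x j) (w k) = Re (W $$ (k, j))" using that by (simp add: x_def F_comb_w)
    then show ?thesis by (simp add: w' that F_add V iso)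
  qed
  have Im_eq: "F (y j) (\<i> *c y k) = Im (W $$ (k, j))" if "k < n" for j k
  proof -
    have "F (y j) (w k) = Im (W $$ (k, j))" using that by (simp add: y_def F_comb_w)
    then show ?thesis by (simp add: w' that F_add V iso)
  qed
  have "W $$ (j, k) = W $$ (k, j)" if jk: "j < n" "k < n" for j k
  proof (rule complex_eqI)
    show "Im (W $$ (j, k)) = Im (W $$ (k, j))"
      using Im_eq[OF jk(1), of k] Im_eq[OF jk(2), of j] F_i_sym[OF V(2)[of j] V(2)[of k]] by simp
    \<comment> \<open>In this expansion the \<open>x\<close>-\<open>x\<close> and
      \<open>y\<close>-\<open>y\<close> terms vanish, the latter by \<open>F_i_i\<close>; the cross
      terms are Re W(k,j) and minus Re W(j,k).\<close>
    have "0 = F (x j + \<i> *c y j) (x k + \<i> *c y k)"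
      using F_w_w[OF jk] by (simp add: w' jk)
    also have "\<dots> = F (x j) (\<i> *c y k) + F (\<i> *c y j) (x k)"
      by (simp add: F_add V subspace_add[OF subspace_V] iso F_i_i)
    also have "F (\<i> *c y j) (x k) = - F (x k) (\<i> *c y j)"
      by (rule F_swap) (rule V)+
    finally show "Re (W $$ (j, k)) = Re (W $$ (k, j))" by (simp add: Re_eq jk)
  qed
  then have sym: "transpose_mat W = W" using W by (intro eq_matI) auto
  have pos: "0 < c \<bullet> (map_mat Im W *\<^sub>v c)" if c: "c \<in> carrier_vec n" "c \<noteq> 0\<^sub>v n" for c
  proof -
    \<comment> \<open>The quadratic form of Im W at \<open>c\<close> is F(Y, \<i>Y), with
      \<open>X\<close> and \<open>Y\<close> the real and imaginary parts of the combination of the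
      \<open>w j\<close> with coefficients \<open>c\<close>. Positivity reduces to \<open>Y\<close>
      being nonzero.\<close>
    define Y where "Y = (\<Sum>j<n. of_real (c $ j) *c y j)"
    define X where "X = (\<Sum>j<n. of_real (c $ j) *c x j)"
    have YV: "Y \<in> V" and XV: "X \<in> V"
      unfolding X_def Y_def by (auto intro!: subspace_sum[OF subspace_V] V_scale V)
    have sum_w: "(\<Sum>j<n. of_real (c $ j) *c w j) = X + \<i> *c Y"
      by (simp add: X_def Y_def w' scale_right_distrib sum.distrib scale_sum_right mult.commute)
    \<comment> \<open>If \<open>Y = 0\<close>, the combination of the \<open>w j\<close> equals
      \<open>X\<close>, in the real span of the \<open>a i\<close>. Pairing with \<open>a k\<close>
      gives \<open>c $ k\<close> on one side and 0 on the other.\<close>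
    have "Y \<noteq> 0"
    proof
      assume "Y = 0"
      have "c $ k = 0" if k: "k < n" for k
      proof -
        have "c $ k = F (a k) (\<Sum>j<n. of_real (c $ j) *c w j)"
          using k by (subst F_sum_right) (auto simp: a_V w_V F_a_w if_distrib cong: if_cong)
        also have "\<dots> = F (a k) X" by (simp add: sum_w \<open>Y = 0\<close>)
        also have "\<dots> = 0"
        proof -
          have "F (a k) (x j) = 0" for j
            unfolding x_def real_comb_def using k
            by (subst F_sum_right) (auto simp: a_V F_a_a)
          then show ?thesis unfolding X_def using k by (subst F_sum_right) (auto simp: a_V V)
        qed
        finally show ?thesis .
      qed
      then have "c = 0\<^sub>v n" using c(1) by (intro eq_vecI) auto
      with c(2) show False by contradiction
    qed
    then have "0 < F Y (\<i> *c Y)" using F_i_pos YV by blast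
    also have iY: "\<i> *c Y = (\<Sum>j<n. of_real (c $ j) *c (\<i> *c y j))"
      by (simp add: Y_def scale_sum_right mult.commute)
    have "F Y (\<i> *c Y) = (\<Sum>k<n. c $ k * F Y (\<i> *c y k))"
      unfolding iY by (rule F_sum_right) (auto simp: V YV)
    also have "\<dots> = (\<Sum>k<n. c $ k * (\<Sum>j<n. c $ j * Im (W $$ (k, j))))"
      unfolding Y_def by (subst F_sum_left) (auto simp: V Im_eq)
    also have "\<dots> = c \<bullet> (map_mat Im W *\<^sub>v c)"
      using W c(1) by (simp add: scalar_prod_def atLeast0LessThan mult.commute)
    finally show ?thesis .
  qed
  show ?thesis using W sym pos by (simp add: siegel_def)
qed

end

theorem theorem4p1:
  fixes scale :: "complex \<Rightarrow> 'v::ab_group_add \<Rightarrow> 'v"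
    and V L V_f L_f :: "'v set"
    and F :: "'v \<Rightarrow> 'v \<Rightarrow> real"
    and f :: "'v \<Rightarrow> 'v"
    and \<alpha> \<beta> us \<alpha>_f :: "'v list"
    and ds ns :: "nat list"
    and g h m :: nat
    and Z :: "complex mat"
    and B1 B2 :: "int mat"
  assumes vs: "vector_space scale"
    and torus: "complex_torus scale V L"
    and dimV: "vector_space.dim scale V = g"
    and pol: "polarization scale V L F"
    and typeA: "has_type scale L F ds" and len_ds: "length ds = g"
    and alpha: "is_basis scale V \<alpha>"
    and beta: "symplectic_basis scale L F ds \<beta>"
    and Z: "Z \<in> siegel g"
    and period: "period_matrix scale \<alpha> \<beta> = hcat (diag_of ds) Z"
    and f: "f \<in> torus_EndQ scale V L"
    and m: "m > 0" "(\<lambda>v. scale (of_nat m) (f v)) \<in> torus_End scale V L"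
    and V_f: "V_f = image_space V (\<lambda>v. scale (of_nat m) (f v))"
    and L_f: "L_f = image_lattice V L (\<lambda>v. scale (of_nat m) (f v))"
    and dim_f: "vector_space.dim scale V_f = h"
    and type_f: "has_type scale L_f F ns" and len_ns: "length ns = h"
    and beta_f: "symplectic_basis scale L_f F ns us"
    and B1: "B1 \<in> carrier_mat (2 * g) h" and B2: "B2 \<in> carrier_mat (2 * g) h"
    and P_f: "rational_rep scale (\<lambda>x. x) us \<beta> = hcat B1 B2"
    and alpha_f: "\<alpha>_f = map (\<lambda>i. scale (1 / of_nat (ns ! i)) (us ! i)) [0..<h]"
  shows "is_basis scale V_f \<alpha>_f \<and>
         analytic_rep scale (\<lambda>x. x) \<alpha>_f \<alpha> =
           hcat (diag_of ds) Z * map_mat of_int B1 * mat_inv (diag_of ns) \<and>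
         (\<exists>W \<in> siegel h.
           period_matrix scale \<alpha>_f us = hcat (diag_of ns) W \<and>
           (\<forall>W' \<in> carrier_mat h h.
              hcat (diag_of ds) Z * map_mat of_int B1 * mat_inv (diag_of ns) * W' =
                hcat (diag_of ds) Z * map_mat of_int B2 \<longleftrightarrow> W' = W))"
proof -
  interpret vector_space scale by fact
  interpret Z: Modules.module "int_scale scale" using vs by (rule restricted_scalars_module)
  have subV: "subspace V" using torus by (simp add: complex_torus_def)
  interpret polarized_space scale V L F using subV pol by unfold_locales
  define \<phi> where "\<phi> = (\<lambda>v. scale (of_nat m) (f v))"
  have \<phi>: "clinear_between scale V V \<phi>"
    using m(2) by (simp add: torus_End_def torus_hom_def \<phi>_def)
  have Vf: "V_f = \<phi> ` V" and Lf: "L_f = \<phi> ` V \<inter> L"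
    using V_f L_f by (simp_all add: image_space_def image_lattice_def \<phi>_def)
  have VfV: "V_f \<subseteq> V" using \<phi> by (auto simp: Vf clinear_between_def)
  \<comment> \<open>Linearity of \<open>\<phi>\<close> is known only on \<open>V\<close>, so closure
    is checked with preimages in \<open>V\<close>.\<close>
  have sub_f: "subspace V_f"
    unfolding Vf
  proof (rule subspaceI)
    have "\<phi> 0 = 0"
      using \<phi> subspace_0[OF subV] unfolding clinear_between_def by (metis scale_zero_left)
    then show "0 \<in> \<phi> ` V" using subspace_0[OF subV] by force
  next
    fix x y assume "x \<in> \<phi> ` V" "y \<in> \<phi> ` V"
    then obtain x' y' where *: "x' \<in> V" "y' \<in> V" "x = \<phi> x'" "y = \<phi> y'" by blast
    then have "x + y = \<phi> (x' + y')" using \<phi> by (simp add: clinear_between_def)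
    then show "x + y \<in> \<phi> ` V" using * subspace_add[OF subV] by blast
  next
    fix c x assume "x \<in> \<phi> ` V"
    then obtain x' where *: "x' \<in> V" "x = \<phi> x'" by blast
    then have "scale c x = \<phi> (scale c x')" using \<phi> by (simp add: clinear_between_def)
    then show "scale c x \<in> \<phi> ` V" using * V_scale by blast
  qed

  have \<alpha>: "distinct \<alpha>" "independent (set \<alpha>)" "span (set \<alpha>) = V"
    using alpha by (auto simp: is_basis_def)
  have \<beta>: "distinct \<beta>" "\<not> Z.dependent (set \<beta>)" "Z.span (set \<beta>) = L"
    using beta by (auto simp: symplectic_basis_def is_basis_def)
  have Lf_span: "Z.span (set us) = L_f" and gram: "gram_mat F us = J_mat ns"
    using beta_f by (auto simp: symplectic_basis_def is_basis_def)
  \<comment> \<open>The lengths come from the shape of the period matrix, which is g by 2g because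
    \<open>Z\<close> is g by g.\<close>
  have len_\<beta>: "length \<beta> = 2 * g" and len_\<alpha>: "length \<alpha> = g"
    using arg_cong[OF period, of dim_col] arg_cong[OF period, of dim_row] Z len_ds
    by (auto simp: period_matrix_def coord_mat_def hcat_def siegel_def diag_of_def mat_diag_def)
  have len_us: "length us = 2 * h"
    using arg_cong[OF gram, of dim_col] len_ns
    by (simp add: gram_mat_def J_mat_def diag_of_def mat_diag_def)
  have us_Lf: "us ! j \<in> L_f" if "j < 2 * h" for j
    using that len_us Z.span_superset[of "set us"] by (auto simp: Lf_span)
  have us_Vf: "us ! j \<in> V_f" and us_L: "us ! j \<in> L" if "j < 2 * h" for j
    using us_Lf[OF that] by (auto simp: Vf Lf)
  have us_V: "us ! j \<in> V" if "j < 2 * h" for j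
    using us_Vf[OF that] VfV by blast
  have ns_pos: "ns ! i > 0" if "i < h" for i
    using that type_f len_ns by (auto simp: has_type_def)
  have F_us: "F (us ! i) (us ! j) = J_mat ns $$ (i, j)" if "i < 2 * h" "j < 2 * h" for i j
    using arg_cong[OF gram, of "\<lambda>M. M $$ (i, j)"] that len_us by (simp add: gram_mat_def)

  define a where "a i = scale (1 / of_nat (ns ! i)) (us ! i)" for i
  define w where "w i = us ! (h + i)" for i
  have us_a: "us ! i = scale (of_nat (ns ! i)) (a i)" if "i < h" for i
    using ns_pos[OF that] by (simp add: a_def)
  \<comment> \<open>Writing the factor as an embedded real makes \<open>F_scale\<close>
    applicable.\<close>
  have a_real: "a i = scale (of_real (1 / real (ns ! i))) (us ! i)" for i
    by (simp add: a_def)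
  \<comment> \<open>The frame is taken in the ambient \<open>V\<close>, with length
    \<open>h\<close>, so that positivity is that of \<open>F\<close> on \<open>V\<close>.\<close>
  interpret lagrangian_frame scale V L F h a w
  proof unfold_locales
    fix i assume i: "i < h"
    show "a i \<in> V" using i us_V by (simp add: a_def V_scale)
    show "w i \<in> V" using i us_V by (simp add: w_def)
    fix j assume j: "j < h"
    show "F (a i) (a j) = 0"
      using i j us_V F_us[of i j] len_ns
      by (simp add: a_real F_scale V_scale del: of_real_divide)
         (simp add: J_mat_def diag_of_def mat_diag_def)
    show "F (w i) (w j) = 0"
      using i j F_us[of "h + i" "h + j"] len_ns
      by (simp add: w_def J_mat_def diag_of_def mat_diag_def)
    show "F (a i) (w j) = (if i = j then 1 else 0)"
      using i j us_V F_us[of i "h + j"] len_ns ns_pos[OF j]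
      by (simp add: a_real w_def F_scale V_scale del: of_real_divide)
         (simp add: J_mat_def diag_of_def mat_diag_def)
  qed

  have \<alpha>f: "\<alpha>_f = map a [0..<h]" using alpha_f by (simp add: a_def)
  have len_\<alpha>f: "length \<alpha>_f = h" by (simp add: \<alpha>f)
  have ind: "distinct \<alpha>_f" "independent (set \<alpha>_f)"
    using distinct_independent_list_iff[of \<alpha>_f] complex_comb_eq_0 by (auto simp: \<alpha>f)
  have \<alpha>f_Vf: "set \<alpha>_f \<subseteq> V_f"
    using us_Vf sub_f by (auto simp: \<alpha>f a_def subspace_scale)
  have span_f: "span (set \<alpha>_f) = V_f"
  \<comment> \<open>There are \<open>h\<close> independent vectors in a space of dimension
    \<open>h\<close>; the basis \<open>\<alpha>\<close> of \<open>V\<close> supplies the finite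
    spanning set.\<close>
  proof (rule span_eq_of_card_ge_dim)
    show "V_f \<subseteq> span (set \<alpha>)" using VfV \<alpha> by simp
    show "dim V_f \<le> card (set \<alpha>_f)" using dim_f ind(1) by (simp add: distinct_card len_\<alpha>f)
  qed (use sub_f ind \<alpha>f_Vf in auto)
  have basis_f: "is_basis scale V_f \<alpha>_f" using ind span_f by (simp add: is_basis_def)

  let ?P = "hcat (diag_of ds) Z :: complex mat"
  have \<beta>_V: "set \<beta> \<subseteq> span (set \<alpha>)"
    using complex_torus_lattice_subset[OF vs torus] Z.span_superset[of "set \<beta>"] \<beta> \<alpha> by auto
  \<comment> \<open>The inclusion is the identity map, so the columns of its rational representation
    are the integral coordinates of the \<open>us ! j\<close>; embedding the integers makes this a
    complex relation.\<close>
  have us_\<beta>: "us ! j = (\<Sum>k<2 * g. scale (of_int (hcat B1 B2 $$ (k, j))) (\<beta> ! k))" if "j < 2 * h" for j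
    using Z.coord_mat_expand[of \<beta> us j] \<beta> us_L[OF that] P_f len_us len_\<beta> that
    by (simp add: rational_rep_def int_scale_def)
  have P: "coord_mat scale \<alpha> \<beta> = ?P" using period by (simp add: period_matrix_def)
  \<comment> \<open>The period matrix of \<open>A\<close> holds the complex coordinates of
    \<open>\<beta>\<close>, so right multiplication by either block yields those of the
    corresponding half of \<open>us\<close>.\<close>
  have B1_eq: "coord_mat scale \<alpha> (map (\<lambda>i. us ! i) [0..<h]) = ?P * map_mat of_int B1"
    unfolding P[symmetric]
    by (rule coord_mat_mult) (use \<alpha> \<beta>_V B1 B2 len_\<beta> us_\<beta> in \<open>auto simp: hcat_def\<close>)
  have B2_eq: "coord_mat scale \<alpha> (map w [0..<h]) = ?P * map_mat of_int B2"
    unfolding P[symmetric]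
    by (rule coord_mat_mult) (use \<alpha> \<beta>_V B1 B2 len_\<beta> us_\<beta> in \<open>auto simp: hcat_def w_def\<close>)

  define Di :: "complex mat" where "Di = mat_diag h (\<lambda>i. 1 / of_nat (ns ! i))"
  have inv: "mat_inv (diag_of ns) = Di"
    unfolding Di_def diag_of_def len_ns by (rule mat_inv_mat_diag) (use ns_pos in auto)
  have rep: "coord_mat scale \<alpha> \<alpha>_f = ?P * map_mat of_int B1 * mat_inv (diag_of ns)"
    unfolding B1_eq[symmetric] inv
  proof (rule coord_mat_mult)
    fix j assume j: "j < length \<alpha>_f"
    then have "\<alpha>_f ! j = (\<Sum>k<h. if k = j then a k else 0)" by (simp add: \<alpha>f)
    also have "\<dots> = (\<Sum>k<h. scale (Di $$ (k, j)) (us ! k))"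
      using j by (intro sum.cong) (auto simp: Di_def mat_diag_def \<alpha>f a_def)
    finally show "\<alpha>_f ! j = (\<Sum>k<length (map ((!) us) [0..<h]).
        scale (Di $$ (k, j)) (map ((!) us) [0..<h] ! k))" by simp
  qed (use \<alpha> us_V in \<open>auto simp: Di_def \<alpha>f\<close>)

  \<comment> \<open>\<open>W\<close> is defined by coordinates and not as a solution of the
    equation, which then becomes a change of coordinates.\<close>
  define W where "W = coord_mat scale \<alpha>_f (map w [0..<h])"
  have W: "W \<in> carrier_mat h h" using len_\<alpha>f by (auto simp: W_def coord_mat_def)
  have w_span: "w j \<in> span (set \<alpha>_f)" if "j < h" for j
    using us_Vf that by (simp add: span_f w_def)
  have w_eq: "w j = (\<Sum>i<h. scale (W $$ (i, j)) (a i))" if "j < h" for j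
    using coord_mat_expand[OF ind, of "map w [0..<h]" j] w_span that
    by (simp add: W_def[symmetric] len_\<alpha>f) (simp add: \<alpha>f)
  have W_siegel: "W \<in> siegel h" using W w_eq by (rule frame_matrix_siegel)
  have period_f: "period_matrix scale \<alpha>_f us = hcat (diag_of ns) W"
    unfolding period_matrix_def
  proof (rule eq_matI)
    fix i j assume "i < dim_row (hcat (diag_of ns) W)" "j < dim_col (hcat (diag_of ns) W)"
    then have i: "i < h" and j: "j < 2 * h"
      using W len_ns by (auto simp: hcat_def diag_of_def mat_diag_def)
    show "coord_mat scale \<alpha>_f us $$ (i, j) = hcat (diag_of ns) W $$ (i, j)"
    proof (cases "j < h")
      case True
      \<comment> \<open>\<open>representation\<close> is indexed by vectors, so distinctness is what
        turns \<open>a j = a i\<close> into \<open>j = i\<close>.\<close>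
      have "a j \<in> set \<alpha>_f" and "(a j = a i) = (j = i)"
        using ind(1) i True nth_eq_iff_index_eq[of \<alpha>_f j i] by (auto simp: \<alpha>f)
      then have "representation (set \<alpha>_f) (us ! j) (a i) = (if i = j then of_nat (ns ! j) else 0)"
        using ind True by (auto simp: us_a representation_scale representation_basis span_base)
      then show ?thesis
        using i j True W len_ns len_us
        by (simp add: coord_mat_def hcat_def diag_of_def mat_diag_def len_\<alpha>f) (auto simp: \<alpha>f)
    next
      case False
      then have "us ! j = w (j - h)" "j - h < h" using j by (auto simp: w_def)
      then show ?thesis
        using i j False W len_ns len_us
        by (simp add: coord_mat_def hcat_def diag_of_def mat_diag_def len_\<alpha>f W_def)
    qed
  qed (use W len_ns len_us len_\<alpha>f in \<open>auto simp: coord_mat_def hcat_def diag_of_def mat_diag_def\<close>)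
  \<comment> \<open>Both sides are the coordinates of the \<open>w j\<close> in
    \<open>\<alpha>\<close>, computed through \<open>\<alpha>_f\<close> on the left and through
    \<open>\<beta>\<close> on the right.\<close>
  have sol: "coord_mat scale \<alpha> \<alpha>_f * W = ?P * map_mat of_int B2"
    unfolding B2_eq[symmetric]
    by (rule coord_mat_mult[symmetric])
       (use \<alpha> \<alpha>f_Vf VfV W len_\<alpha>f w_eq in \<open>auto simp: \<alpha>f\<close>)
  \<comment> \<open>The coefficient matrix is g by h, in general not square, so uniqueness rests on
    the independence of \<open>\<alpha>_f\<close> and not on inversion.\<close>
  have uniq: "W' = W"
    if "W' \<in> carrier_mat h h" "coord_mat scale \<alpha> \<alpha>_f * W' = ?P * map_mat of_int B2" for W'
  proof (rule coord_mat_mult_cancel)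
    show "coord_mat scale \<alpha> \<alpha>_f * W' = coord_mat scale \<alpha> \<alpha>_f * W"
      using that(2) sol by simp
  qed (use \<alpha> ind \<alpha>f_Vf VfV W that(1) len_\<alpha>f in auto)
  show ?thesis
    using basis_f rep W_siegel period_f sol uniq
    unfolding analytic_rep_def rep[symmetric] by (auto simp: rep)
qed

end
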